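(* Let $\mathbf{F}_q$ be the finite field with $q$ elements. Let $P_3(x_1,x_2,x_3)$ and $Q_3(x_1,x_2,x_3)$ be homogeneous polynomials of degree $3$ and $Q_4(x_1,x_2,x_3)$ a homogeneous polynomial of degree $4$ (standard grading), with coefficients in $\mathbf{F}_q$, not all three zero. Let $\widetilde X_5^{(3)}\subset \mathbf{P}_{\widetilde\Sigma_L}$ be the RC-quintic $3$-fold over $\mathbf{F}_q$ with equation $$x_0^2P_3(x_1,x_2,x_3)+x_0x_4Q_3(x_1,x_2,x_3)+x_4x_5Q_4(x_1,x_2,x_3)=0 .$$ Then $$\sharp\,\widetilde X_5^{(3)}(\mathbf{F}_q)\equiv 1 \pmod q .$$
   Context: For a field $K$, $\mathbf{P}_{\widetilde\Sigma_L}$ denotes the blow-up of $\mathbf{P}^4_K$ along the line $L=\{x_1=x_2=x_3=0\}$, realized as the toric variety $(\mathbf{A}^6\setminus Z)/\mathbf{G}_m^2$, where $\mathbf{A}^6$ has coordinates $(x_0,\dots,x_5)$, the exceptional set is $$Z=\{x_1=x_2=x_3=0\}\cup\{x_0=x_4=x_5=0\},$$ and $\mathbf{G}_m^2$ acts by $(\lambda,\mu)\cdot(x_0,\dots,x_5)=(\lambda\mu x_0,\lambda x_1,\lambda x_2,\lambda x_3,\lambda\mu x_4,\mu x_5)$. Its $K$-points are the classes of points of $K^6\setminus Z(K)$ modulo $(K^* )^2$. The blow-up map to $\mathbf{P}^4$ is $[x_0,\dots,x_5]\mapsto[x_0,x_5x_1,x_5x_2,x_5x_3,x_4]$. The polynomial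 in the equation is bihomogeneous of bidegree $(5,2)$ for the grading $\deg x_1=\deg x_2=\deg x_3=(1,0)$, $\deg x_5=(0,1)$, $\deg x_0=\deg x_4=(1,1)$, so its vanishing is well defined on $\mathbf{P}_{\widetilde\Sigma_L}$; $\widetilde X_5^{(3)}(\mathbf{F}_q)$ is the set of $\mathbf{F}_q$-points of $\mathbf{P}_{\widetilde\Sigma_L}$ where it vanishes. "RC-quintic $3$-fold" is the name for such a hypersurface: it is the strict transform under the blow-up of the quintic $x_0^2P_3+x_0x_4Q_3+x_4Q_4=0$ in $\mathbf{P}^4$, which contains $L$ with multiplicity $3$. No smoothness is assumed. *)

theory Defs
  imports
    "HOL-Library.Poly_Mapping"
    "HOL-Library.Numeral_Type"
    "HOL-Analysis.Finite_Cartesian_Product"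
    "HOL-Number_Theory.Cong"
begin

text \<open>
  The index type \<open>6\<close> has the six elements \<open>0, 1, 2, 3, 4, 5\<close>, so points of affine 6-space
  are vectors \<open>x :: 'a ^ 6\<close> with coordinates \<open>x $ 0, ..., x $ 5\<close>, and a polynomial in
  \<open>x\<^sub>0, ..., x\<^sub>5\<close> is a finitely supported function from exponent vectors to coefficients.
\<close>

type_synonym 'a poly6 = "(6 \<Rightarrow>\<^sub>0 nat) \<Rightarrow>\<^sub>0 'a"

definition X :: "6 \<Rightarrow> 'a::comm_ring_1 poly6" where
  "X i = Poly_Mapping.single (Poly_Mapping.single i 1) 1"

definition eval6 :: "'a::comm_ring_1 poly6 \<Rightarrow> 'a ^ 6 \<Rightarrow> 'a" where
  "eval6 p x =
     (\<Sum>m\<in>Poly_Mapping.keys p.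
        Poly_Mapping.lookup p m * (\<Prod>i\<in>UNIV. (x $ i) ^ Poly_Mapping.lookup m i))"

text \<open>Homogeneous of degree \<open>d\<close> for the standard grading, involving only the variables
  \<open>x\<^sub>1, x\<^sub>2, x\<^sub>3\<close>; the zero polynomial is included.\<close>

definition homogeneous123 :: "nat \<Rightarrow> 'a::comm_ring_1 poly6 \<Rightarrow> bool" where
  "homogeneous123 d p \<longleftrightarrow>
     (\<forall>m\<in>Poly_Mapping.keys p.
        Poly_Mapping.keys m \<subseteq> {1, 2, 3} \<and> (\<Sum>i\<in>UNIV. Poly_Mapping.lookup m i) = d)"

definition exceptional_set :: "('a::field ^ 6) set" where
  "exceptional_set =
     {x. x $ 1 = 0 \<and> x $ 2 = 0 \<and> x $ 3 = 0} \<union> {x. x $ 0 = 0 \<and> x $ 4 = 0 \<and> x $ 5 = 0}"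

definition torus_act :: "'a::field \<Rightarrow> 'a \<Rightarrow> 'a ^ 6 \<Rightarrow> 'a ^ 6" where
  "torus_act l m x =
     (\<chi> i. if i \<in> {0, 4} then l * m * x $ i else if i = 5 then m * x $ i else l * x $ i)"

definition torus_rel :: "(('a::field ^ 6) \<times> ('a ^ 6)) set" where
  "torus_rel =
     {(x, y). x \<in> - exceptional_set \<and> y \<in> - exceptional_set \<and>
        (\<exists>l m. l \<noteq> 0 \<and> m \<noteq> 0 \<and> y = torus_act l m x)}"

text \<open>The rational points, over the field \<open>'a\<close>, of the blow-up of projective 4-space along
  the line \<open>x\<^sub>1 = x\<^sub>2 = x\<^sub>3 = 0\<close>.\<close>

definition blowup_points :: "('a::field ^ 6) set set" where
  "blowup_points = (- exceptional_set) // torus_rel"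

definition RC_quintic_poly :: "'a::comm_ring_1 poly6 \<Rightarrow> 'a poly6 \<Rightarrow> 'a poly6 \<Rightarrow> 'a poly6" where
  "RC_quintic_poly P3 Q3 Q4 = X 0 ^ 2 * P3 + X 0 * X 4 * Q3 + X 4 * X 5 * Q4"

definition RC_quintic_points ::
    "'a::field poly6 \<Rightarrow> 'a poly6 \<Rightarrow> 'a poly6 \<Rightarrow> ('a ^ 6) set set" where
  "RC_quintic_points P3 Q3 Q4 =
     {C \<in> blowup_points. \<forall>x\<in>C. eval6 (RC_quintic_poly P3 Q3 Q4) x = 0}"

text \<open>The action induces an equivalence relation on the complement of the exceptional set, and
  the equation is bihomogeneous of bidegree \<open>(5, 2)\<close>; hence its vanishing at a class does not
  depend on the representative.\<close>

lemma eval6_superset: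
  assumes "finite S" "Poly_Mapping.keys p \<subseteq> S"
  shows "eval6 p x = (\<Sum>m\<in>S. Poly_Mapping.lookup p m * (\<Prod>i\<in>UNIV. (x $ i) ^ Poly_Mapping.lookup m i))"
  unfolding eval6_def by (rule sum.mono_neutral_left) (use assms in \<open>auto simp: in_keys_iff\<close>)

lemma eval6_add: "eval6 (p + r) x = eval6 p x + eval6 r x"
proof -
  let ?S = "Poly_Mapping.keys p \<union> Poly_Mapping.keys r"
  have "finite ?S" "Poly_Mapping.keys (p + r) \<subseteq> ?S" by (auto dest: Poly_Mapping.keys_add[THEN subsetD])
  then show ?thesis
    by (simp add: eval6_superset[of ?S] lookup_add distrib_right sum.distrib)
qed

lemma eval6_0 [simp]: "eval6 0 x = 0" by (simp add: eval6_def)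

lemma eval6_single: "eval6 (Poly_Mapping.single m c) x = c * (\<Prod>i\<in>UNIV. (x $ i) ^ Poly_Mapping.lookup m i)"
  by (subst eval6_superset[of "{m}"]) auto

lemma poly_ind:
  assumes "P 0" "\<And>m c. P (Poly_Mapping.single m c)" "\<And>a b. P a \<Longrightarrow> P b \<Longrightarrow> P (a + b)"
  shows "P (p :: 'a::comm_ring_1 poly6)"
proof -
  have "p = (\<Sum>m\<in>Poly_Mapping.keys p. Poly_Mapping.single m (Poly_Mapping.lookup p m))"
    by (rule poly_mapping_eqI) (simp add: lookup_sum lookup_single when_def in_keys_iff)
  moreover have "finite A \<Longrightarrow> P (\<Sum>m\<in>A. Poly_Mapping.single m (Poly_Mapping.lookup p m))" for A
    by (induction A rule: finite_induct) (auto intro: assms)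
  ultimately show ?thesis by (metis finite_keys)
qed

lemma eval6_single_mult: "eval6 (Poly_Mapping.single m c * r) x = eval6 (Poly_Mapping.single m c) x * eval6 r x"
proof (induction r rule: poly_ind)
  case (2 k d) show ?case by (simp add: mult_single eval6_single lookup_add power_add prod.distrib)
next
  case (3 a b) then show ?case by (simp add: distrib_left eval6_add)
qed simp

lemma eval6_mult: "eval6 (p * r) x = eval6 p x * eval6 r x"
  by (induction p rule: poly_ind)
    (auto simp: eval6_single_mult distrib_right eval6_add)

lemma eval6_X: "eval6 (X i) x = x $ i"
  unfolding X_def eval6_single
  by (simp add: lookup_single when_def if_distrib[of "power _"] cong: if_cong)

lemma eval6_RC:
  "eval6 (RC_quintic_poly P3 Q3 Q4) x =
    (x $ 0)^2 * eval6 P3 x + x $ 0 * x $ 4 * eval6 Q3 x + x $ 4 * x $ 5 * eval6 Q4 x"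
  by (simp add: RC_quintic_poly_def eval6_add eval6_mult eval6_X power2_eq_square)

lemma eval6_act:
  assumes "homogeneous123 d p"
  shows "eval6 p (torus_act l m x) = l ^ d * eval6 p x"
proof -
  { fix k assume k: "k \<in> Poly_Mapping.keys p"
    have a: "Poly_Mapping.keys k \<subseteq> {1, 2, 3}" and b: "(\<Sum>i\<in>UNIV. Poly_Mapping.lookup k i) = d"
      using assms k by (auto simp: homogeneous123_def)
    have "(torus_act l m x $ i) ^ Poly_Mapping.lookup k i = l ^ Poly_Mapping.lookup k i * (x $ i) ^ Poly_Mapping.lookup k i" for i
    proof (cases "i \<in> Poly_Mapping.keys k")
      case True
      then have "i \<in> {1,2,3}" using a by auto
      then show ?thesis by (auto simp: torus_act_def power_mult_distrib)
    qed (simp add: in_keys_iff)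
    then have "(\<Prod>i\<in>UNIV. (torus_act l m x $ i) ^ Poly_Mapping.lookup k i) = l ^ d * (\<Prod>i\<in>UNIV. (x $ i) ^ Poly_Mapping.lookup k i)"
      by (simp add: prod.distrib b[symmetric] power_sum) }
  then show ?thesis by (simp add: eval6_def sum_distrib_left mult_ac)
qed

lemma RC_quintic_poly_torus_act:
  assumes "homogeneous123 3 P3" "homogeneous123 3 Q3" "homogeneous123 4 Q4"
  shows "eval6 (RC_quintic_poly P3 Q3 Q4) (torus_act l m x)
    = l ^ 5 * m ^ 2 * eval6 (RC_quintic_poly P3 Q3 Q4) x"
  by (simp add: eval6_RC eval6_act[OF assms(1)] eval6_act[OF assms(2)] eval6_act[OF assms(3)])
    (simp add: torus_act_def algebra_simps eval_nat_numeral)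

lemma torus_act_exceptional: assumes "l \<noteq> 0" "m \<noteq> 0"
  shows "torus_act l m x \<in> exceptional_set \<longleftrightarrow> x \<in> exceptional_set"
  using assms by (auto simp: torus_act_def exceptional_set_def)

lemma equiv_torus_rel:
  "equiv (- exceptional_set) (torus_rel :: (('a::field ^ 6) \<times> ('a ^ 6)) set)"
proof (rule equivI)
  show "torus_rel \<subseteq> (- exceptional_set) \<times> (- exceptional_set)" by (auto simp: torus_rel_def)
  show "refl_on (- exceptional_set) torus_rel"
    by (auto simp: refl_on_def torus_rel_def torus_act_def vec_eq_iff intro!: exI[of _ 1])
  show "sym (torus_rel :: (('a ^ 6) \<times> ('a ^ 6)) set)"
  proof (rule symI)
    fix x y :: "'a ^ 6" assume "(x, y) \<in> torus_rel"
    then obtain l m where *: "l \<noteq> 0" "m \<noteq> 0" "y = torus_act l m x" "x \<in> - exceptional_set" "y \<in> - exceptional_set"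
      by (auto simp: torus_rel_def)
    then have "x = torus_act (inverse l) (inverse m) y"
      by (auto simp: torus_act_def vec_eq_iff field_simps)
    moreover have "inverse l \<noteq> 0" "inverse m \<noteq> 0" using * by auto
    ultimately show "(y, x) \<in> torus_rel" using * unfolding torus_rel_def by blast
  qed
  show "trans (torus_rel :: (('a ^ 6) \<times> ('a ^ 6)) set)"
  proof (rule transI)
    fix x y z :: "'a ^ 6" assume "(x, y) \<in> torus_rel" "(y, z) \<in> torus_rel"
    then obtain l m l' m' where *: "l \<noteq> 0" "m \<noteq> 0" "y = torus_act l m x" "x \<in> - exceptional_set" "z \<in> - exceptional_set"
      "l' \<noteq> 0" "m' \<noteq> 0" "z = torus_act l' m' y"
      by (auto simp: torus_rel_def)
    then have "z = torus_act (l * l') (m * m') x"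
      by (auto simp: torus_act_def vec_eq_iff)
    moreover have "l * l' \<noteq> 0" "m * m' \<noteq> 0" using * by auto
    ultimately show "(x, z) \<in> torus_rel" using * unfolding torus_rel_def by blast
  qed
qed

lemma RC_quintic_points_iff:
  assumes "homogeneous123 3 P3" "homogeneous123 3 Q3" "homogeneous123 4 Q4"
    and "x \<in> - exceptional_set"
  shows "torus_rel `` {x} \<in> RC_quintic_points P3 Q3 Q4
    \<longleftrightarrow> eval6 (RC_quintic_poly P3 Q3 Q4) x = 0"
proof -
  have "(x, x) \<in> torus_rel"
    using equiv_torus_rel assms(4) by (auto simp: equiv_def refl_on_def)
  moreover have "torus_rel `` {x} \<in> blowup_points"
    unfolding blowup_points_def using assms(4) by (rule quotientI)
  moreover have "eval6 (RC_quintic_poly P3 Q3 Q4) y = 0"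
    if "(x, y) \<in> torus_rel" "eval6 (RC_quintic_poly P3 Q3 Q4) x = 0" for y
    using that by (auto simp: torus_rel_def RC_quintic_poly_torus_act[OF assms(1-3)])
  ultimately show ?thesis
    unfolding RC_quintic_points_def by auto
qed

end

theory Submission imports Defs begin

text \<open>
  The torus acts freely with orbits of size \<open>(q - 1)\<^sup>2 \<equiv> 1\<close>, so it suffices to count solutions
  \<open>x \<in> \<F>\<^sub>q\<^sup>6\<close> outside the exceptional set. Write \<open>v = (x\<^sub>1, x\<^sub>2, x\<^sub>3)\<close> and
  \<open>w = (x\<^sub>0, x\<^sub>4, x\<^sub>5)\<close>. The solutions with \<open>v \<noteq> 0\<close> split into lines: where
  \<open>x\<^sub>4 Q\<^sub>4(v) = 0\<close> the coordinate \<open>x\<^sub>5\<close> is free, and where \<open>x\<^sub>4 Q\<^sub>4(v) \<noteq> 0\<close> the coordinate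
  \<open>x\<^sub>0\<close> is free and determines \<open>x\<^sub>5\<close>. Hence their number is \<open>0\<close> modulo \<open>q\<close>. Removing the
  \<open>q\<^sup>3 - 1\<close> points with \<open>v \<noteq> 0\<close>, \<open>w = 0\<close>, all of them solutions, leaves \<open>1\<close> modulo \<open>q\<close>.
\<close>

text \<open>The nonempty fibres of \<open>p\<close> partition \<open>T\<close>. In the applications
  \<open>p\<close> sets the varying coordinates to 0, so that its fibres are curves with q points
  each.\<close>

lemma dvd_card_fibres:
  assumes "finite T" and "\<And>x. x \<in> T \<Longrightarrow> n dvd card {y \<in> T. p y = p x}"
  shows "n dvd card T"
proof -
  have "card T = (\<Sum>z\<in>p ` T. card {y \<in> T. p y = z})"
    using sum.image_gen[OF assms(1), of "\<lambda>_. 1 :: nat" p] by simp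
  then show ?thesis
    using assms(2) by (auto intro!: dvd_sum)
qed

definition vec_upd :: "'n \<Rightarrow> 'a \<Rightarrow> 'a ^ 'n \<Rightarrow> 'a ^ 'n::finite" where
  "vec_upd i c x = (\<chi> j. if j = i then c else x $ j)"

lemma vec_upd_nth [simp]: "vec_upd i c x $ j = (if j = i then c else x $ j)"
  by (simp add: vec_upd_def)

text \<open>Every monomial of \<open>p\<close> has exponent 0 outside the indices 1, 2, 3. Hence
  \<open>P3\<close>, \<open>Q3\<close> and \<open>Q4\<close> keep their values while only
  \<open>x $ 0\<close>, \<open>x $ 4\<close> or \<open>x $ 5\<close> changes.\<close>

lemma eval6_cong123:
  assumes "homogeneous123 d p" and "x $ 1 = y $ 1" "x $ 2 = y $ 2" "x $ 3 = y $ 3"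
  shows "eval6 p x = eval6 p y"
proof -
  have "(x $ i) ^ Poly_Mapping.lookup k i = (y $ i) ^ Poly_Mapping.lookup k i"
    if k: "k \<in> Poly_Mapping.keys p" for k i
  proof (cases "i \<in> Poly_Mapping.keys k")
    case True
    then have "i \<in> {1, 2, 3}"
      using assms(1) k by (auto simp: homogeneous123_def)
    then show ?thesis using assms by auto
  qed (simp add: in_keys_iff)
  then show ?thesis by (simp add: eval6_def)
qed

text \<open>The six numerals are distinct, so by cardinality they exhaust the index type; this turns
  equality of vectors into six coordinate equations.\<close>

lemma forall_6: "(\<forall>i::6. P i) \<longleftrightarrow> P 0 \<and> P 1 \<and> P 2 \<and> P 3 \<and> P 4 \<and> P 5"
proof -
  have "card {0, 1, 2, 3, 4, 5 :: 6} = CARD(6)" by simp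
  then have UNIV: "(UNIV :: 6 set) = {0, 1, 2, 3, 4, 5}"
    by (metis card_subset_eq finite subset_UNIV)
  have "(\<forall>i::6. P i) \<longleftrightarrow> (\<forall>i\<in>UNIV. P i)" by simp
  then show ?thesis unfolding UNIV by simp
qed

lemma torus_class_eq:
  assumes "x \<in> - exceptional_set"
  shows "torus_rel `` {x} = (\<lambda>(l, m). torus_act l m x) ` ((- {0}) \<times> (- {0}))"
proof -
  have "torus_act l m x \<in> - exceptional_set" if "l \<noteq> 0" "m \<noteq> 0" for l m
    using assms torus_act_exceptional[OF that] by blast
  then show ?thesis
    using assms unfolding torus_rel_def by (auto simp: image_iff)
qed

text \<open>Freeness of the action: a nonzero coordinate among 1, 2, 3 determines \<open>l\<close>;
  since \<open>l\<close> is nonzero, a nonzero coordinate among 0, 4, 5 then determines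
  \<open>m\<close>.\<close>

lemma inj_on_torus_act:
  fixes x :: "'a::field ^ 6"
  assumes "x \<in> - exceptional_set"
  shows "inj_on (\<lambda>(l, m). torus_act l m x) ((- {0}) \<times> (- {0}))"
proof (clarsimp simp: inj_on_def)
  fix l m l' m' :: 'a
  assume nz: "l \<noteq> 0" "m \<noteq> 0" "l' \<noteq> 0" "m' \<noteq> 0"
    and eq: "torus_act l m x = torus_act l' m' x"
  have l: "l = l'"
    using assms eq by (auto simp: exceptional_set_def torus_act_def vec_eq_iff forall_6)
  moreover have "m = m'"
    using assms eq nz unfolding l by (auto simp: exceptional_set_def torus_act_def vec_eq_iff forall_6)
  ultimately show "l = l' \<and> m = m'" by simp
qed

lemma card_torus_class:
  fixes x :: "'a::{field, finite} ^ 6"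
  assumes "x \<in> - exceptional_set"
  shows "card (torus_rel `` {x}) = (CARD('a) - 1)\<^sup>2"
  unfolding torus_class_eq[OF assms] card_image[OF inj_on_torus_act[OF assms]]
  by (simp add: card_cartesian_product Compl_eq_Diff_UNIV power2_eq_square)

theorem mainTheorem2:
  fixes P3 Q3 Q4 :: "'a::{field, finite} poly6"
    and q :: nat
  assumes "CARD('a) = q"
    and "homogeneous123 3 P3"
    and "homogeneous123 3 Q3"
    and "homogeneous123 4 Q4"
    and "\<not> (P3 = 0 \<and> Q3 = 0 \<and> Q4 = 0)"
  shows "[card (RC_quintic_points P3 Q3 Q4) = 1] (mod q)"
proof -
  define f where "f = eval6 (RC_quintic_poly P3 Q3 Q4)"
  define N where "N = card (RC_quintic_points P3 Q3 Q4)"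
  define S where "S = {x \<in> - exceptional_set. f x = 0}"
  define V where "V = {x :: 'a ^ 6. x $ 1 = 0 \<and> x $ 2 = 0 \<and> x $ 3 = 0}"
  define W where "W = {x :: 'a ^ 6. x $ 0 = 0 \<and> x $ 4 = 0 \<and> x $ 5 = 0}"
  define A where "A = {x \<in> - V. f x = 0 \<and> x $ 4 * eval6 Q4 x = 0}"
  define B where "B = {x \<in> - V. f x = 0 \<and> x $ 4 * eval6 Q4 x \<noteq> 0}"
  note hom = assms(2-4)
  note f = f_def eval6_RC
  have card_image_UNIV: "card (range h) = q" if "inj h" for h :: "'a \<Rightarrow> 'a ^ 6"
    using card_image[OF that] assms(1) by simp

  have "q dvd card A"
  proof (rule dvd_card_fibres[where p = "vec_upd 5 0"])
    fix x assume x: "x \<in> A"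
    have ev: "eval6 p (vec_upd 5 c x) = eval6 p x" if "homogeneous123 d p" for p d c
      by (rule eval6_cong123[OF that]) auto
    \<comment> \<open>On \<open>A\<close> the term containing \<open>x $ 5\<close> vanishes, and
      none of the conditions defining \<open>A\<close> depends on that coordinate.\<close>
    have "{y \<in> A. vec_upd 5 0 y = vec_upd 5 0 x} = range (\<lambda>c. vec_upd 5 c x)"
    proof (intro set_eqI iffI)
      fix y assume "y \<in> {y \<in> A. vec_upd 5 0 y = vec_upd 5 0 x}"
      then have "y = vec_upd 5 (y $ 5) x" by (auto simp: vec_eq_iff forall_6)
      then show "y \<in> range (\<lambda>c. vec_upd 5 c x)" by blast
    next
      fix y assume "y \<in> range (\<lambda>c. vec_upd 5 c x)"
      then obtain c where "y = vec_upd 5 c x" by blast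
      moreover have "vec_upd 5 0 (vec_upd 5 c x) = vec_upd 5 0 x"
        by (simp add: vec_eq_iff)
      ultimately show "y \<in> {y \<in> A. vec_upd 5 0 y = vec_upd 5 0 x}"
        using x by (auto simp: A_def V_def f ev[OF hom(1)] ev[OF hom(2)] ev[OF hom(3)])
    qed
    moreover have "inj (\<lambda>c. vec_upd 5 c x)"
      by (auto simp: inj_def vec_eq_iff)
    ultimately show "q dvd card {y \<in> A. vec_upd 5 0 y = vec_upd 5 0 x}"
      by (simp add: card_image_UNIV)
  qed simp
  moreover have "q dvd card B"
  proof (rule dvd_card_fibres[where p = "\<lambda>x. vec_upd 0 0 (vec_upd 5 0 x)"])
    fix x assume x: "x \<in> B"
    \<comment> \<open>For \<open>x $ 0 = c\<close> the equation is linear in \<open>x $ 5\<close>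
      with nonzero coefficient \<open>x $ 4 * eval6 Q4 x\<close>; \<open>x5 c\<close> is its unique
      root. So \<open>h\<close> parametrizes the fibre by its coordinate 0.\<close>
    define x5 where "x5 c = - (c\<^sup>2 * eval6 P3 x + c * x $ 4 * eval6 Q3 x) / (x $ 4 * eval6 Q4 x)" for c
    define h where "h c = vec_upd 0 c (vec_upd 5 (x5 c) x)" for c
    have ev: "eval6 p y = eval6 p x"
      if "homogeneous123 d p" "vec_upd 0 0 (vec_upd 5 0 y) = vec_upd 0 0 (vec_upd 5 0 x)" for p d y
      by (rule eval6_cong123[OF that(1)]) (use that(2) in \<open>auto simp: vec_eq_iff forall_6\<close>)
    have h: "vec_upd 0 0 (vec_upd 5 0 (h c)) = vec_upd 0 0 (vec_upd 5 0 x)" for c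
      by (auto simp: h_def vec_eq_iff)
    have Q4: "x $ 4 * eval6 Q4 x \<noteq> 0" using x by (simp add: B_def)
    have "{y \<in> B. vec_upd 0 0 (vec_upd 5 0 y) = vec_upd 0 0 (vec_upd 5 0 x)} = range h"
    proof (intro set_eqI iffI)
      fix y assume y: "y \<in> {y \<in> B. vec_upd 0 0 (vec_upd 5 0 y) = vec_upd 0 0 (vec_upd 5 0 x)}"
      then have y': "vec_upd 0 0 (vec_upd 5 0 y) = vec_upd 0 0 (vec_upd 5 0 x)" by simp
      then have y4: "y $ 4 = x $ 4" by (auto simp: vec_eq_iff forall_6)
      have "f y = 0" using y by (simp add: B_def)
      then have "y $ 5 * (x $ 4 * eval6 Q4 x) =
          - ((y $ 0)\<^sup>2 * eval6 P3 x + y $ 0 * x $ 4 * eval6 Q3 x)"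
        by (simp add: f ev[OF hom(1) y'] ev[OF hom(2) y'] ev[OF hom(3) y'] y4
            eq_neg_iff_add_eq_0 algebra_simps)
      then have "y $ 5 = x5 (y $ 0)"
        unfolding x5_def using Q4 by (metis nonzero_eq_divide_eq)
      then have "y = h (y $ 0)"
        using y' by (auto simp: h_def vec_eq_iff forall_6)
      then show "y \<in> range h" by blast
    next
      fix y assume "y \<in> range h"
      then obtain c where c: "y = h c" by blast
      have "x5 c * (x $ 4 * eval6 Q4 x) = - (c\<^sup>2 * eval6 P3 x + c * x $ 4 * eval6 Q3 x)"
        unfolding x5_def using Q4 by simp
      then have "x $ 4 * x5 c * eval6 Q4 x = - (c\<^sup>2 * eval6 P3 x + c * x $ 4 * eval6 Q3 x)"
        by (simp add: ac_simps)
      then have "f (h c) = 0"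
        unfolding f ev[OF hom(1) h] ev[OF hom(2) h] ev[OF hom(3) h] by (simp add: h_def)
      then show "y \<in> {y \<in> B. vec_upd 0 0 (vec_upd 5 0 y) = vec_upd 0 0 (vec_upd 5 0 x)}"
        using x h[of c] ev[OF hom(3) h, of c] unfolding c by (auto simp: B_def V_def h_def)
    qed
    moreover have "inj h"
      by (auto simp: inj_def h_def vec_eq_iff forall_6)
    ultimately show "q dvd card {y \<in> B. vec_upd 0 0 (vec_upd 5 0 y) = vec_upd 0 0 (vec_upd 5 0 x)}"
      by (simp add: card_image_UNIV)
  qed simp
  \<comment> \<open>\<open>W\<close> is a linear space with coordinates 1, 2, 3 free; varying the
    first alone gives the divisibility.\<close>
  moreover have "q dvd card W"
  proof (rule dvd_card_fibres[where p = "vec_upd 1 0"])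
    fix x assume x: "x \<in> W"
    have "{y \<in> W. vec_upd 1 0 y = vec_upd 1 0 x} = range (\<lambda>c. vec_upd 1 c x)"
    proof (intro set_eqI iffI)
      fix y assume "y \<in> {y \<in> W. vec_upd 1 0 y = vec_upd 1 0 x}"
      then have "y = vec_upd 1 (y $ 1) x" by (auto simp: vec_eq_iff forall_6)
      then show "y \<in> range (\<lambda>c. vec_upd 1 c x)" by blast
    qed (use x in \<open>auto simp: W_def vec_eq_iff\<close>)
    moreover have "inj (\<lambda>c. vec_upd 1 c x)"
      by (auto simp: inj_def vec_eq_iff)
    ultimately show "q dvd card {y \<in> W. vec_upd 1 0 y = vec_upd 1 0 x}"
      by (simp add: card_image_UNIV)
  qed simp
  \<comment> \<open>Every point of \<open>W\<close> solves the equation, and \<open>V\<close> meets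
    \<open>W\<close> only in the origin. So \<open>S\<close> and \<open>W\<close> together make up
    the solutions off \<open>V\<close> and the origin, which accounts for the 1.\<close>
  moreover have "card S + card W = card A + card B + 1"
  proof -
    have fW: "f x = 0" if "x \<in> W" for x
      using that by (simp add: W_def f)
    have VW: "x \<in> V \<Longrightarrow> x \<in> W \<Longrightarrow> x = 0" for x
      by (auto simp: V_def W_def vec_eq_iff forall_6)
    have 0: "0 \<in> V" "0 \<in> W" by (auto simp: V_def W_def)
    have "S = {x. x \<notin> V \<and> x \<notin> W \<and> f x = 0}"
      by (auto simp: S_def V_def W_def exceptional_set_def)
    then have "S \<union> W = insert 0 (A \<union> B)" "S \<inter> W = {}" "A \<inter> B = {}" "0 \<notin> A \<union> B"
      using fW VW 0 by (auto simp: A_def B_def)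
    then show ?thesis
      by (metis Suc_eq_plus1 card_Un_disjoint card_insert_disjoint finite)
  qed
  ultimately have S: "[card S = 1] (mod q)"
    by (metis (no_types, lifting) cong_add_rcancel_0_nat cong_def dvd_add mod_add_right_eq
        mod_add_left_eq dvd_imp_mod_0 add.right_neutral add.left_neutral)

  \<comment> \<open>Points of the variety are whole torus orbits, so \<open>S\<close> can be counted
    orbit by orbit.\<close>
  have S_Union: "S = \<Union> (RC_quintic_points P3 Q3 Q4)"
  proof (intro set_eqI iffI)
    fix x assume x: "x \<in> S"
    then have "torus_rel `` {x} \<in> RC_quintic_points P3 Q3 Q4"
      by (auto simp: S_def f_def RC_quintic_points_iff[OF hom])
    moreover have "x \<in> torus_rel `` {x}"
      using x equiv_class_self[OF equiv_torus_rel] by (auto simp: S_def)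
    ultimately show "x \<in> \<Union> (RC_quintic_points P3 Q3 Q4)" by blast
  next
    fix x assume "x \<in> \<Union> (RC_quintic_points P3 Q3 Q4)"
    then show "x \<in> S"
      using Union_quotient[OF equiv_torus_rel]
      by (auto simp: S_def f_def RC_quintic_points_def blowup_points_def)
  qed
  have "card S = (\<Sum>C\<in>RC_quintic_points P3 Q3 Q4. card C)"
    unfolding S_Union
  proof (rule card_Union_disjoint)
    show "pairwise disjnt (RC_quintic_points P3 Q3 Q4)"
      using quotient_disj[OF equiv_torus_rel]
      by (fastforce simp: pairwise_def disjnt_def RC_quintic_points_def blowup_points_def)
  qed simp
  also have "\<dots> = (\<Sum>C\<in>RC_quintic_points P3 Q3 Q4. (q - 1)\<^sup>2)"
    by (rule sum.cong) (auto simp: RC_quintic_points_def blowup_points_def card_torus_class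
        assms(1) elim!: quotientE)
  finally have N: "card S = N * (q - 1)\<^sup>2" by (simp add: N_def)
  have "q > 0" using assms(1) zero_less_card_finite[where 'a = 'a] by simp
  then obtain r where r: "q = Suc r" by (cases q) auto
  \<comment> \<open>Over the integers q - 1 is congruent to -1, so the orbit size is congruent to 1
    and drops out of the count.\<close>
  have "[int r = - 1] (mod int q)"
    by (simp add: cong_iff_dvd_diff r add.commute)
  then have "[int N * int r ^ 2 = int N * (- 1) ^ 2] (mod int q)"
    by (intro cong_mult cong_pow cong_refl)
  then have "[int (card S) = int N] (mod int q)"
    by (simp add: N r)
  then have "[card S = N] (mod q)" by (simp only: cong_int_iff)
  then show ?thesis
    using S unfolding N_def by (metis cong_trans cong_sym)
qed

end
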